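(* Let $f:\mathbb{R}^n\to\mathbb{R}$ be twice continuously differentiable with $L_H$-Lipschitz continuous gradient on $\mathbb{R}^n$, with nonempty set of minimizers, minimal value $f_*$, and with $\{x:f(x)\le f(x_0)\}$ bounded for every $x_0\in\mathbb{R}^n$. Let $\{x_k\}_{k\in\mathbb{N}}$ be a sequence generated by the inexact regularized Newton method with line search described in the context. Then a point with $\|\nabla f(x_k)\|\le\epsilon$ is reached within at most $\mathcal{O}(\epsilon^{-2})$ iterations: there is a constant $C>0$, depending only on $L_H$, $c$, $\tau$, $\theta$ and $f(x_0)-f_*$, such that for every $\epsilon\in(0,1]$ there is an index $k\le C\epsilon^{-2}$ with $\|\nabla f(x_k)\|\le\epsilon$.
   Context: $\|\cdot\|$ is the Euclidean norm, $\lambda_{\min}$ the smallest eigenvalue. Inexact regularized Newton method with line search. Parameters: $x_0\in\mathbb{R}^n$, $c>0$, $\tau\in(0,c)$, $\mu_1\in(0,1]$, $\mu_2\in(0,\mu_1]$, $\delta\in[0,1]$, $\theta\in(0,1)$ (convention $0^0=1$). For $k=0,1,\dots$, set $$\varsigma_k=\max\{0,-\lambda_{\min}(\nabla^2f(x_k))\}+c+\mu_1\min\{1,\|\nabla f(x_k)\|^{\delta}\},$$ choose $d_k\in\mathbb{R}^n$ with $$\|(\nabla^2f(x_k)+\varsigma_kI)d_k+\nabla f(x_k)\|\le\frac{\mu_2}{2}\min\{1,\|\nabla f(x_k)\|^{\delta}\}\|d_k\|,$$ and set $x_{k+1}=x_k+\alpha_kd_k$, where $\alpha_k=\theta^{j_k}$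 and $j_k$ is the smallest nonnegative integer $j$ such that $f(x_k+\theta^{j}d_k)\le f(x_k)-\frac{\tau}{2}\theta^{j}\|d_k\|^2$. The sequence is the infinite sequence produced without a stopping test. *)

theory Defs
  imports Complex_Main "Jordan_Normal_Form.Spectral_Radius"
begin

(* R^n is "carrier_vec n" rather than a type "real ^ 'n": the constant of the complexity
   bound must not depend on n, so n has to be quantified inside the statement.  Functions on
   R^n have type "real vec => _"; only their values on "carrier_vec n" matter. *)

definition enorm :: "real vec \<Rightarrow> real" where
  "enorm v = sqrt (v \<bullet> v)"

(* Frechet differentiability *)
definition has_gradient :: "nat \<Rightarrow> (real vec \<Rightarrow> real) \<Rightarrow> real vec \<Rightarrow> real vec \<Rightarrow> bool" where
  "has_gradient n f g x \<longleftrightarrow> g \<in> carrier_vec n \<and>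
     (\<forall>e>0. \<exists>r>0. \<forall>h\<in>carrier_vec n. enorm h < r \<longrightarrow>
        \<bar>f (x + h) - f x - g \<bullet> h\<bar> \<le> e * enorm h)"

definition has_jacobian ::
    "nat \<Rightarrow> (real vec \<Rightarrow> real vec) \<Rightarrow> real mat \<Rightarrow> real vec \<Rightarrow> bool" where
  "has_jacobian n F J x \<longleftrightarrow> J \<in> carrier_mat n n \<and>
     (\<forall>e>0. \<exists>r>0. \<forall>h\<in>carrier_vec n. enorm h < r \<longrightarrow>
        enorm (F (x + h) - F x - J *\<^sub>v h) \<le> e * enorm h)"

definition continuous_Rn :: "nat \<Rightarrow> (real vec \<Rightarrow> real) \<Rightarrow> bool" where
  "continuous_Rn n \<phi> \<longleftrightarrow> (\<forall>x\<in>carrier_vec n. \<forall>e>0. \<exists>r>0. \<forall>y\<in>carrier_vec n.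
      enorm (y - x) < r \<longrightarrow> \<bar>\<phi> y - \<phi> x\<bar> < e)"

(* f is of class C^2 on R^n, with gradient g and Hessian H (which f determines uniquely) *)
definition C2_with :: "nat \<Rightarrow> (real vec \<Rightarrow> real) \<Rightarrow> (real vec \<Rightarrow> real vec) \<Rightarrow>
    (real vec \<Rightarrow> real mat) \<Rightarrow> bool" where
  "C2_with n f g H \<longleftrightarrow>
     (\<forall>x\<in>carrier_vec n. has_gradient n f (g x) x) \<and>
     (\<forall>x\<in>carrier_vec n. has_jacobian n g (H x) x) \<and>
     (\<forall>i<n. \<forall>j<n. continuous_Rn n (\<lambda>x. H x $$ (i, j)))"

definition lipschitz_Rn :: "nat \<Rightarrow> real \<Rightarrow> (real vec \<Rightarrow> real vec) \<Rightarrow> bool" where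
  "lipschitz_Rn n L F \<longleftrightarrow> 0 \<le> L \<and>
     (\<forall>x\<in>carrier_vec n. \<forall>y\<in>carrier_vec n. enorm (F x - F y) \<le> L * enorm (x - y))"

definition bounded_Rn :: "nat \<Rightarrow> real vec set \<Rightarrow> bool" where
  "bounded_Rn n S \<longleftrightarrow> S \<subseteq> carrier_vec n \<and> (\<exists>B. \<forall>x\<in>S. enorm x \<le> B)"

definition is_min_value :: "nat \<Rightarrow> (real vec \<Rightarrow> real) \<Rightarrow> real \<Rightarrow> bool" where
  "is_min_value n f m \<longleftrightarrow>
     (\<exists>z\<in>carrier_vec n. f z = m \<and> (\<forall>y\<in>carrier_vec n. f z \<le> f y))"

definition lambda_min :: "real mat \<Rightarrow> real" where
  "lambda_min A = Min (spectrum A)"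

(* real powers with 0^0 = 1, whereas "0 powr 0 = 0" *)
definition rpow :: "real \<Rightarrow> real \<Rightarrow> real" where
  "rpow a p = (if p = 0 then 1 else a powr p)"

definition reg_param :: "real \<Rightarrow> real \<Rightarrow> real \<Rightarrow> real vec \<Rightarrow> real mat \<Rightarrow> real" where
  "reg_param c \<mu>\<^sub>1 \<delta> g A =
     max 0 (- lambda_min A) + c + \<mu>\<^sub>1 * min 1 (rpow (enorm g) \<delta>)"

definition inexact_step :: "nat \<Rightarrow> real \<Rightarrow> real \<Rightarrow> real \<Rightarrow> real \<Rightarrow>
    real vec \<Rightarrow> real mat \<Rightarrow> real vec \<Rightarrow> bool" where
  "inexact_step n c \<mu>\<^sub>1 \<mu>\<^sub>2 \<delta> g A d \<longleftrightarrow> d \<in> carrier_vec n \<and>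
     enorm ((A + reg_param c \<mu>\<^sub>1 \<delta> g A \<cdot>\<^sub>m 1\<^sub>m n) *\<^sub>v d + g)
       \<le> \<mu>\<^sub>2 / 2 * min 1 (rpow (enorm g) \<delta>) * enorm d"

definition sufficient_decrease :: "(real vec \<Rightarrow> real) \<Rightarrow> real \<Rightarrow> real \<Rightarrow>
    real vec \<Rightarrow> real vec \<Rightarrow> nat \<Rightarrow> bool" where
  "sufficient_decrease f \<tau> \<theta> x d j \<longleftrightarrow>
     f (x + \<theta> ^ j \<cdot>\<^sub>v d) \<le> f x - \<tau> / 2 * \<theta> ^ j * (enorm d)\<^sup>2"

(* x is a sequence generated by the method; g and H are the gradient and Hessian of f *)
definition newton_sequence :: "nat \<Rightarrow> (real vec \<Rightarrow> real) \<Rightarrow> (real vec \<Rightarrow> real vec) \<Rightarrow>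
    (real vec \<Rightarrow> real mat) \<Rightarrow> real \<Rightarrow> real \<Rightarrow> real \<Rightarrow> real \<Rightarrow> real \<Rightarrow> real \<Rightarrow>
    real vec \<Rightarrow> (nat \<Rightarrow> real vec) \<Rightarrow> bool" where
  "newton_sequence n f g H c \<tau> \<theta> \<mu>\<^sub>1 \<mu>\<^sub>2 \<delta> x\<^sub>0 x \<longleftrightarrow>
     x 0 = x\<^sub>0 \<and>
     (\<exists>d j. \<forall>k.
        inexact_step n c \<mu>\<^sub>1 \<mu>\<^sub>2 \<delta> (g (x k)) (H (x k)) (d k) \<and>
        sufficient_decrease f \<tau> \<theta> (x k) (d k) (j k) \<and>
        (\<forall>i<j k. \<not> sufficient_decrease f \<tau> \<theta> (x k) (d k) i) \<and>
        x (Suc k) = x k + \<theta> ^ j k \<cdot>\<^sub>v d k)"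

end

(* Since the gradient is L-Lipschitz, the Hessian is bounded by L, so the regularization is at most
   L + c + 1 and the gradient is at most (2 L + c + 2) times as long as the step d_k.  The
   regularized Hessian dominates c + mu_1 min {1, |g_k|^delta}, which exceeds c by more than the
   residual can undo, so d_k is a descent direction with <g_k, d_k> <= - c |d_k|^2.  A rejected
   trial step is therefore at least c / (2 (L + c)), so every accepted step decreases f by at least
   a constant times |g_k|^2, and summing against f(x_0) - f_* gives the rate. *)
theory Submission
  imports Defs "HOL-Analysis.L2_Norm"
begin

section \<open>Euclidean norm, Cauchy-Schwarz inequality and crude matrix bounds\<close>

lemma enorm_L2: "enorm v = L2_set (($) v) {0..<dim_vec v}"
  by (simp add: enorm_def L2_set_def scalar_prod_def power2_eq_square)

lemma enorm_ge_0 [simp]: "0 \<le> enorm v"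
  by (simp add: enorm_L2)

lemma enorm_power2: "(enorm v)\<^sup>2 = v \<bullet> v"
  by (simp add: enorm_def scalar_prod_def sum_nonneg)

lemma enorm_0 [simp]: "enorm (0\<^sub>v n) = 0"
  by (simp add: enorm_def scalar_prod_def)

lemma enorm_eq_0_iff: "v \<in> carrier_vec n \<Longrightarrow> enorm v = 0 \<longleftrightarrow> v = 0\<^sub>v n"
  by (auto simp: enorm_L2 L2_set_eq_0_iff)

lemma enorm_smult [simp]: "enorm (a \<cdot>\<^sub>v v) = \<bar>a\<bar> * enorm v"
proof -
  have "(a \<cdot>\<^sub>v v) \<bullet> (a \<cdot>\<^sub>v v) = a\<^sup>2 * (v \<bullet> v)"
    by (simp add: scalar_prod_def power2_eq_square sum_distrib_left mult_ac)
  then show ?thesis by (simp add: enorm_def real_sqrt_mult)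
qed

lemma enorm_triangle:
  assumes "u \<in> carrier_vec n" "v \<in> carrier_vec n"
  shows "enorm (u + v) \<le> enorm u + enorm v"
proof -
  have "enorm (u + v) = L2_set (\<lambda>i. u $ i + v $ i) {0..<n}"
    using assms by (auto simp: enorm_L2 intro!: L2_set_cong)
  also have "\<dots> \<le> L2_set (($) u) {0..<n} + L2_set (($) v) {0..<n}"
    by (rule L2_set_triangle_ineq)
  finally show ?thesis using assms by (simp add: enorm_L2)
qed

lemma enorm_triangle_minus:
  assumes "u \<in> carrier_vec n" "v \<in> carrier_vec n"
  shows "enorm (u - v) \<le> enorm u + enorm v"
proof -
  have "u - v = u + (-1) \<cdot>\<^sub>v v" using assms by (intro eq_vecI) auto
  then show ?thesis using enorm_triangle[of u n "(-1) \<cdot>\<^sub>v v"] assms by simp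
qed

lemma abs_scalar_prod_le:
  fixes u v :: "real vec"
  assumes "u \<in> carrier_vec n" "v \<in> carrier_vec n"
  shows "\<bar>u \<bullet> v\<bar> \<le> enorm u * enorm v"
proof -
  have "\<bar>u \<bullet> v\<bar> \<le> (\<Sum>i\<in>{0..<n}. \<bar>u $ i\<bar> * \<bar>v $ i\<bar>)"
    using assms sum_abs[of "\<lambda>i. u $ i * v $ i" "{0..<n}"] by (simp add: scalar_prod_def abs_mult)
  also have "\<dots> \<le> L2_set (($) u) {0..<n} * L2_set (($) v) {0..<n}"
    by (rule L2_set_mult_ineq)
  finally show ?thesis using assms by (simp add: enorm_L2)
qed

text \<open>Replaces the operator norm where only finiteness matters. Cauchy-Schwarz in each row
  gives a bound that may grow with \<open>n\<close>; this is harmless, because it serves only the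
  eigenvalue argument and never enters the complexity constant.\<close>

lemma enorm_mult_mat_vec_bound:
  fixes A :: "real mat"
  assumes A: "A \<in> carrier_mat n n"
  obtains K where "K > 0" "\<And>v. v \<in> carrier_vec n \<Longrightarrow> enorm (A *\<^sub>v v) \<le> K * enorm v"
proof
  let ?K = "(\<Sum>i<n. enorm (row A i)) + 1"
  show "?K > 0" by (simp add: add_nonneg_pos sum_nonneg)
  fix v :: "real vec" assume v: "v \<in> carrier_vec n"
  have "enorm (A *\<^sub>v v) \<le> (\<Sum>i\<in>{0..<n}. \<bar>(A *\<^sub>v v) $ i\<bar>)"
    using A L2_set_le_sum_abs[of "($) (A *\<^sub>v v)" "{0..<n}"] by (simp add: enorm_L2)
  also have "\<dots> \<le> (\<Sum>i\<in>{0..<n}. enorm (row A i) * enorm v)"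
    using A v by (intro sum_mono) (auto intro!: abs_scalar_prod_le[of _ n])
  also have "\<dots> = (\<Sum>i<n. enorm (row A i)) * enorm v"
    by (simp add: sum_distrib_right atLeast0LessThan)
  also have "\<dots> \<le> ?K * enorm v" by (simp add: distrib_right)
  finally show "enorm (A *\<^sub>v v) \<le> ?K * enorm v" .
qed

section \<open>Derivatives along lines and symmetry of the Hessian\<close>

text \<open>Restriction to a line makes the one-variable mean value theorem available, both for
  second differences and for the descent estimate.\<close>

lemma has_gradient_line_derivative:
  assumes grad: "\<And>y. y \<in> carrier_vec n \<Longrightarrow> has_gradient n f (g y) y"
    and p: "p \<in> carrier_vec n" and v: "v \<in> carrier_vec n"
  shows "((\<lambda>t. f (p + t \<cdot>\<^sub>v v)) has_real_derivative g (p + t \<cdot>\<^sub>v v) \<bullet> v) (at t)"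
  unfolding has_field_derivative_def has_derivative_at_within
proof (intro conjI bounded_linear_mult_right)
  let ?y = "p + t \<cdot>\<^sub>v v"
  have y: "?y \<in> carrier_vec n" using p v by simp
  then have gc: "g ?y \<in> carrier_vec n" using grad by (auto simp: has_gradient_def)
  have "\<forall>e>0. \<exists>r>0. \<forall>s. 0 < \<bar>s - t\<bar> \<and> \<bar>s - t\<bar> < r \<longrightarrow>
      \<bar>(f (p + s \<cdot>\<^sub>v v) - f ?y - (g ?y \<bullet> v) * (s - t)) / (s - t)\<bar> < e"
  proof (intro allI impI)
    fix e :: real assume e: "e > 0"
    \<comment> \<open>The \<open>+ 1\<close> avoids division by zero for \<open>v = 0\<close> and
      makes \<open>e' * enorm v < e\<close> strict, as the limit demands although
      \<open>has_gradient\<close> offers only \<le>.\<close>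
    define e' where "e' = e / (enorm v + 1)"
    have "e' > 0" using e by (simp add: e'_def add_nonneg_pos)
    then obtain r where r: "r > 0"
      "\<And>h. h \<in> carrier_vec n \<Longrightarrow> enorm h < r \<Longrightarrow> \<bar>f (?y + h) - f ?y - g ?y \<bullet> h\<bar> \<le> e' * enorm h"
      using grad[OF y] by (auto simp: has_gradient_def)
    show "\<exists>r>0. \<forall>s. 0 < \<bar>s - t\<bar> \<and> \<bar>s - t\<bar> < r \<longrightarrow>
      \<bar>(f (p + s \<cdot>\<^sub>v v) - f ?y - (g ?y \<bullet> v) * (s - t)) / (s - t)\<bar> < e"
    proof (intro exI[of _ "r / (enorm v + 1)"] conjI allI impI)
      show "0 < r / (enorm v + 1)" using r by (simp add: add_nonneg_pos)
      fix s assume s: "0 < \<bar>s - t\<bar> \<and> \<bar>s - t\<bar> < r / (enorm v + 1)"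
      define h where "h = (s - t) \<cdot>\<^sub>v v"
      have h: "h \<in> carrier_vec n" using v by (simp add: h_def)
      have "\<bar>s - t\<bar> * (enorm v + 1) < r" using s by (simp add: pos_less_divide_eq add_nonneg_pos)
      then have "enorm h < r" by (simp add: h_def algebra_simps)
      from r(2)[OF h this] have "\<bar>f (?y + h) - f ?y - g ?y \<bullet> h\<bar> \<le> e' * enorm h" .
      moreover have "?y + h = p + s \<cdot>\<^sub>v v"
        using p v by (intro eq_vecI) (auto simp: h_def algebra_simps)
      moreover have "g ?y \<bullet> h = (g ?y \<bullet> v) * (s - t)" using gc v by (simp add: h_def)
      ultimately have "\<bar>f (p + s \<cdot>\<^sub>v v) - f ?y - (g ?y \<bullet> v) * (s - t)\<bar> \<le> e' * enorm v * \<bar>s - t\<bar>"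
        by (simp add: h_def mult_ac)
      moreover have "e' * enorm v < e" using e by (simp add: e'_def pos_divide_less_eq add_nonneg_pos)
      ultimately have "\<bar>f (p + s \<cdot>\<^sub>v v) - f ?y - (g ?y \<bullet> v) * (s - t)\<bar> < e * \<bar>s - t\<bar>"
        using s by (meson le_less_trans mult_strict_right_mono)
      then show "\<bar>(f (p + s \<cdot>\<^sub>v v) - f ?y - (g ?y \<bullet> v) * (s - t)) / (s - t)\<bar> < e"
        using s by (simp add: pos_divide_less_eq)
    qed
  qed
  then show "((\<lambda>s. (f (p + s \<cdot>\<^sub>v v) - f ?y - (g ?y \<bullet> v) * (s - t)) /\<^sub>R norm (s - t)) \<longlongrightarrow> 0) (at t)"
    by (simp add: LIM_def dist_real_def abs_mult divide_inverse mult.commute)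
qed

text \<open>
  The second difference is symmetric in \<open>u\<close> and \<open>v\<close>, so this estimate yields the symmetry of
  the Hessian, using its existence at the single point \<open>x\<close> only.
\<close>
lemma second_difference_bound:
  assumes grad: "\<And>y. y \<in> carrier_vec n \<Longrightarrow> has_gradient n f (g y) y"
    and jac: "has_jacobian n g A x"
    and x: "x \<in> carrier_vec n" and u: "u \<in> carrier_vec n" and v: "v \<in> carrier_vec n"
    and e: "e > 0"
  shows "\<exists>r>0. \<forall>s. 0 < s \<and> s < r \<longrightarrow>
    \<bar>f (x + s \<cdot>\<^sub>v u + s \<cdot>\<^sub>v v) - f (x + s \<cdot>\<^sub>v u) - f (x + s \<cdot>\<^sub>v v) + f x - s\<^sup>2 * ((A *\<^sub>v u) \<bullet> v)\<bar> \<le> e * s\<^sup>2"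
proof -
  have A: "A \<in> carrier_mat n n" using jac by (simp add: has_jacobian_def)
  have gc: "g y \<in> carrier_vec n" if "y \<in> carrier_vec n" for y
    using grad[OF that] by (simp add: has_gradient_def)
  define K where "K = enorm u + enorm v"
  have K: "K \<ge> 0" by (simp add: K_def)
  \<comment> \<open>Each of the two linearization errors below contributes at most
    \<open>e' * (s * K) * enorm v\<close>, and the mean value theorem supplies another factor
    \<open>s\<close>; this choice keeps the total within \<open>e * s\<^sup>2\<close>.\<close>
  define e' where "e' = e / (2 * K * enorm v + 1)"
  have e': "e' > 0" using e K by (simp add: e'_def add_nonneg_pos)
  then obtain r where r: "r > 0"
    "\<And>h. h \<in> carrier_vec n \<Longrightarrow> enorm h < r \<Longrightarrow> enorm (g (x + h) - g x - A *\<^sub>v h) \<le> e' * enorm h"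
    using jac by (auto simp: has_jacobian_def)
  show ?thesis
  proof (intro exI[of _ "r / (K + 1)"] conjI allI impI)
    show "0 < r / (K + 1)" using r K by simp
    fix s assume s: "0 < s \<and> s < r / (K + 1)"
    then have sK: "s * K < r" using K by (simp add: pos_less_divide_eq algebra_simps)
    \<comment> \<open>\<open>F s - F 0\<close> is the second difference. One mean value step in
      direction \<open>v\<close> turns it into a difference of gradients at two points near
      \<open>x\<close>; both are then expanded about \<open>x\<close>, so no second derivative
      elsewhere appears.\<close>
    define F where "F t = f ((x + s \<cdot>\<^sub>v u) + t \<cdot>\<^sub>v v) - f (x + t \<cdot>\<^sub>v v)" for t
    define F' where "F' t = g ((x + s \<cdot>\<^sub>v u) + t \<cdot>\<^sub>v v) \<bullet> v - g (x + t \<cdot>\<^sub>v v) \<bullet> v" for t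
    have "(F has_real_derivative F' t) (at t)" for t
      unfolding F_def F'_def using x u v
      by (intro DERIV_diff has_gradient_line_derivative[OF grad]) auto
    then obtain t where t: "0 < t" "t < s" and mvt: "F s - F 0 = (s - 0) * F' t"
      using MVT2[of 0 s F F'] s by auto
    define h1 where "h1 = s \<cdot>\<^sub>v u + t \<cdot>\<^sub>v v"
    define h2 where "h2 = t \<cdot>\<^sub>v v"
    have h: "h1 \<in> carrier_vec n" "h2 \<in> carrier_vec n" using u v by (simp_all add: h1_def h2_def)
    have tv: "t * enorm v \<le> s * enorm v" using t by (intro mult_right_mono) auto
    have "enorm h1 \<le> s * enorm u + t * enorm v"
      using enorm_triangle[of "s \<cdot>\<^sub>v u" n "t \<cdot>\<^sub>v v"] u v s t by (simp add: h1_def)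
    with tv have h1: "enorm h1 \<le> s * K" by (simp add: K_def distrib_left)
    have "0 \<le> s * enorm u" using s by simp
    with tv have "t * enorm v \<le> s * K" unfolding K_def distrib_left by linarith
    then have h2: "enorm h2 \<le> s * K" using t by (simp add: h2_def)
    \<comment> \<open>Remainders of the linearization at \<open>x\<close>. In \<open>w1 - w2\<close>
      the terms \<open>g x\<close> and \<open>A *\<^sub>v h2\<close> cancel, and of the linear parts
      only \<open>s \<cdot>\<^sub>v (A *\<^sub>v u)\<close> survives.\<close>
    define w1 where "w1 = g (x + h1) - g x - A *\<^sub>v h1"
    define w2 where "w2 = g (x + h2) - g x - A *\<^sub>v h2"
    have gx: "g x \<in> carrier_vec n" "g (x + h1) \<in> carrier_vec n" "g (x + h2) \<in> carrier_vec n"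
      using x h gc by auto
    have w: "w1 \<in> carrier_vec n" "w2 \<in> carrier_vec n" using A h x gc by (auto simp: w1_def w2_def)
    have "enorm w1 \<le> e' * enorm h1" unfolding w1_def using r h h1 sK by simp
    also have "\<dots> \<le> e' * (s * K)" using h1 e' by (intro mult_left_mono) auto
    finally have w1: "enorm w1 \<le> e' * (s * K)" .
    have "enorm w2 \<le> e' * enorm h2" unfolding w2_def using r h h2 sK by simp
    also have "\<dots> \<le> e' * (s * K)" using h2 e' by (intro mult_left_mono) auto
    finally have w2: "enorm w2 \<le> e' * (s * K)" .
    have "enorm (w1 - w2) \<le> 2 * e' * (s * K)" using enorm_triangle_minus[OF w] w1 w2 by simp
    then have "enorm (w1 - w2) * enorm v \<le> 2 * e' * (s * K) * enorm v"
      by (intro mult_right_mono) auto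
    with abs_scalar_prod_le[of "w1 - w2" n v] w v
    have w12: "\<bar>(w1 - w2) \<bullet> v\<bar> \<le> 2 * e' * (s * K) * enorm v" by simp
    have "A *\<^sub>v h1 = s \<cdot>\<^sub>v (A *\<^sub>v u) + A *\<^sub>v h2"
      using A u v by (simp add: h1_def h2_def mult_add_distrib_mat_vec mult_mat_vec)
    then have "w1 - w2 = g (x + h1) - g (x + h2) - s \<cdot>\<^sub>v (A *\<^sub>v u)"
      unfolding w1_def w2_def using A u gx h by (intro eq_vecI) auto
    then have "(w1 - w2) \<bullet> v = g (x + h1) \<bullet> v - g (x + h2) \<bullet> v - s * ((A *\<^sub>v u) \<bullet> v)"
      using A u v gx
      by (simp add: minus_scalar_prod_distrib[of _ n])
    moreover have "x + s \<cdot>\<^sub>v u + t \<cdot>\<^sub>v v = x + h1"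
      using x u v by (intro eq_vecI) (auto simp: h1_def)
    ultimately have F't: "(w1 - w2) \<bullet> v = F' t - s * ((A *\<^sub>v u) \<bullet> v)"
      by (simp add: F'_def h2_def)
    have F0: "F s - F 0 = f (x + s \<cdot>\<^sub>v u + s \<cdot>\<^sub>v v) - f (x + s \<cdot>\<^sub>v u) - f (x + s \<cdot>\<^sub>v v) + f x"
    proof -
      have "x + 0 \<cdot>\<^sub>v v = x" "x + s \<cdot>\<^sub>v u + 0 \<cdot>\<^sub>v v = x + s \<cdot>\<^sub>v u" using x u v by (auto intro!: eq_vecI)
      then show ?thesis by (simp add: F_def)
    qed
    have "F s - F 0 - s\<^sup>2 * ((A *\<^sub>v u) \<bullet> v) = s * ((w1 - w2) \<bullet> v)"
      by (simp add: mvt F't power2_eq_square algebra_simps)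
    also have "\<bar>\<dots>\<bar> \<le> s * (2 * e' * (s * K) * enorm v)"
      using w12 s by (simp add: abs_mult)
    also have "\<dots> = e' * (2 * K * enorm v) * s\<^sup>2" by (simp add: power2_eq_square)
    also have "\<dots> \<le> e * s\<^sup>2"
    proof (rule mult_right_mono)
      have "0 < 2 * K * enorm v + 1" using K by (simp add: add_nonneg_pos)
      then show "e' * (2 * K * enorm v) \<le> e" using e by (simp add: e'_def field_simps)
    qed simp
    finally show "\<bar>f (x + s \<cdot>\<^sub>v u + s \<cdot>\<^sub>v v) - f (x + s \<cdot>\<^sub>v u) - f (x + s \<cdot>\<^sub>v v) + f x
        - s\<^sup>2 * ((A *\<^sub>v u) \<bullet> v)\<bar> \<le> e * s\<^sup>2" by (simp add: F0)
  qed
qed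

text \<open>For one \<open>s\<close> below both radii, the two bilinear values times
  \<open>s\<^sup>2\<close> approximate the same second difference, so they differ by at most
  \<open>e * s\<^sup>2\<close>; divide by \<open>s\<^sup>2\<close>. Symmetry is what lets the real
  spectrum control the quadratic form later on.\<close>

lemma hessian_symmetric:
  assumes grad: "\<And>y. y \<in> carrier_vec n \<Longrightarrow> has_gradient n f (g y) y"
    and jac: "has_jacobian n g A x"
    and x: "x \<in> carrier_vec n" and u: "u \<in> carrier_vec n" and v: "v \<in> carrier_vec n"
  shows "(A *\<^sub>v u) \<bullet> v = (A *\<^sub>v v) \<bullet> u"
proof -
  have "\<bar>(A *\<^sub>v u) \<bullet> v - (A *\<^sub>v v) \<bullet> u\<bar> \<le> 0 + e" if e: "e > 0" for e
  proof -
    have e2: "e / 2 > 0" using e by simp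
    obtain r1 where r1: "r1 > 0" "\<And>s. 0 < s \<and> s < r1 \<Longrightarrow>
      \<bar>f (x + s \<cdot>\<^sub>v u + s \<cdot>\<^sub>v v) - f (x + s \<cdot>\<^sub>v u) - f (x + s \<cdot>\<^sub>v v) + f x - s\<^sup>2 * ((A *\<^sub>v u) \<bullet> v)\<bar> \<le> e / 2 * s\<^sup>2"
      using second_difference_bound[OF grad jac x u v e2] by blast
    obtain r2 where r2: "r2 > 0" "\<And>s. 0 < s \<and> s < r2 \<Longrightarrow>
      \<bar>f (x + s \<cdot>\<^sub>v v + s \<cdot>\<^sub>v u) - f (x + s \<cdot>\<^sub>v v) - f (x + s \<cdot>\<^sub>v u) + f x - s\<^sup>2 * ((A *\<^sub>v v) \<bullet> u)\<bar> \<le> e / 2 * s\<^sup>2"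
      using second_difference_bound[OF grad jac x v u e2] by blast
    define s where "s = min r1 r2 / 2"
    have s: "0 < s" "s < r1" "s < r2" using r1(1) r2(1) by (auto simp: s_def)
    have "x + s \<cdot>\<^sub>v v + s \<cdot>\<^sub>v u = x + s \<cdot>\<^sub>v u + s \<cdot>\<^sub>v v" using x u v by (intro eq_vecI) auto
    with r1(2)[of s] r2(2)[of s] s
    have "\<bar>s\<^sup>2 * ((A *\<^sub>v u) \<bullet> v) - s\<^sup>2 * ((A *\<^sub>v v) \<bullet> u)\<bar> \<le> e / 2 * s\<^sup>2 + e / 2 * s\<^sup>2"
      unfolding abs_le_iff by force
    also have "\<dots> = s\<^sup>2 * e" by simp
    finally have "s\<^sup>2 * \<bar>(A *\<^sub>v u) \<bullet> v - (A *\<^sub>v v) \<bullet> u\<bar> \<le> s\<^sup>2 * e"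
      by (simp add: abs_mult flip: right_diff_distrib)
    then show ?thesis using s by (simp add: mult_le_cancel_left)
  qed
  then have "\<bar>(A *\<^sub>v u) \<bullet> v - (A *\<^sub>v v) \<bullet> u\<bar> \<le> 0" by (rule field_le_epsilon)
  then show ?thesis by simp
qed

section \<open>The smallest eigenvalue of a symmetric matrix\<close>

lemma smult_one_mult_mat_vec:
  fixes v :: "real vec"
  assumes "v \<in> carrier_vec n"
  shows "(a \<cdot>\<^sub>m 1\<^sub>m n) *\<^sub>v v = a \<cdot>\<^sub>v v"
  using assms by (intro eq_vecI) auto

text \<open>The form is nonnegative at \<open>v - B v / K\<close>, and expanding it there gives the
  claim without any diagonalization. The use: where the form of \<open>B\<close> is small on the
  sphere, \<open>B v\<close> itself must be small.\<close>

lemma psd_mult_mat_vec_bound: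
  fixes B :: "real mat"
  assumes B: "B \<in> carrier_mat n n"
    and sym: "\<And>u v. u \<in> carrier_vec n \<Longrightarrow> v \<in> carrier_vec n \<Longrightarrow> (B *\<^sub>v u) \<bullet> v = (B *\<^sub>v v) \<bullet> u"
    and psd: "\<And>v. v \<in> carrier_vec n \<Longrightarrow> 0 \<le> (B *\<^sub>v v) \<bullet> v"
    and K: "K > 0" "\<And>v. v \<in> carrier_vec n \<Longrightarrow> enorm (B *\<^sub>v v) \<le> K * enorm v"
    and v: "v \<in> carrier_vec n"
  shows "(enorm (B *\<^sub>v v))\<^sup>2 \<le> K * ((B *\<^sub>v v) \<bullet> v)"
proof -
  define w where "w = B *\<^sub>v v"
  define z where "z = B *\<^sub>v w"
  have w: "w \<in> carrier_vec n" using B v by (simp add: w_def)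
  then have z: "z \<in> carrier_vec n" using B by (simp add: z_def)
  \<comment> \<open>This \<open>a\<close> minimizes the upper bound \<open>w \<bullet> v + 2 * a *
    (enorm w)\<^sup>2 + a * a * K * (enorm w)\<^sup>2\<close> of the expanded form.\<close>
  define a where "a = - 1 / K"
  have "B *\<^sub>v (v + a \<cdot>\<^sub>v w) = w + a \<cdot>\<^sub>v z"
    using B v w by (simp add: w_def z_def mult_add_distrib_mat_vec mult_mat_vec)
  then have "0 \<le> (w + a \<cdot>\<^sub>v z) \<bullet> (v + a \<cdot>\<^sub>v w)" using psd[of "v + a \<cdot>\<^sub>v w"] v w by simp
  also have "\<dots> = w \<bullet> v + a * (w \<bullet> w) + a * (z \<bullet> v) + a * a * (z \<bullet> w)"
    using v w z by (simp add: add_scalar_prod_distrib[of _ n] scalar_prod_add_distrib[of _ n])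
      (simp add: algebra_simps)
  also have "z \<bullet> v = (enorm w)\<^sup>2" using sym[OF w v] by (simp add: z_def w_def enorm_power2)
  also have "w \<bullet> w = (enorm w)\<^sup>2" by (simp add: enorm_power2)
  finally have *: "0 \<le> w \<bullet> v + 2 * a * (enorm w)\<^sup>2 + a * a * (z \<bullet> w)" by simp
  have "z \<bullet> w \<le> enorm z * enorm w" using abs_scalar_prod_le[OF z w] by simp
  also have "\<dots> \<le> (K * enorm w) * enorm w" unfolding z_def
    by (intro mult_right_mono K w) auto
  also have "\<dots> = K * (enorm w)\<^sup>2" by (simp add: power2_eq_square)
  finally have "a * a * (z \<bullet> w) \<le> a * a * (K * (enorm w)\<^sup>2)" by (intro mult_left_mono) auto
  also have "\<dots> = - a * (enorm w)\<^sup>2" using K by (simp add: a_def)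
  finally have "0 \<le> w \<bullet> v + a * (enorm w)\<^sup>2" using * by simp
  then show ?thesis using K by (simp add: a_def w_def field_simps)
qed

text \<open>
  The infimum \<open>m\<close> of the quadratic form on the unit sphere is an eigenvalue: otherwise
  \<open>A - m I\<close> would be positive semidefinite and invertible, hence bounded below by a positive
  constant on the sphere. This avoids a compactness argument.
\<close>
lemma symmetric_matrix_min_eigenvalue:
  fixes A :: "real mat"
  assumes A: "A \<in> carrier_mat n n" and n: "n \<ge> 1"
    and sym: "\<And>u v. u \<in> carrier_vec n \<Longrightarrow> v \<in> carrier_vec n \<Longrightarrow> (A *\<^sub>v u) \<bullet> v = (A *\<^sub>v v) \<bullet> u"
  shows "\<exists>m. eigenvalue A m \<and> (\<forall>v\<in>carrier_vec n. m * (enorm v)\<^sup>2 \<le> (A *\<^sub>v v) \<bullet> v)"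
proof -
  define S where "S = {(A *\<^sub>v v) \<bullet> v | v. v \<in> carrier_vec n \<and> enorm v = 1}"
  define m where "m = Inf S"
  obtain K where K: "K > 0" "\<And>v. v \<in> carrier_vec n \<Longrightarrow> enorm (A *\<^sub>v v) \<le> K * enorm v"
    using enorm_mult_mat_vec_bound[OF A] by blast
  \<comment> \<open>The infimum is meaningful only if the sphere is nonempty, which is where
    \<open>n \<ge> 1\<close> enters.\<close>
  have "unit_vec n 0 \<bullet> unit_vec n 0 = (1::real)" using n by simp
  then have ne: "S \<noteq> {}" unfolding S_def using n
    by (auto simp: enorm_def intro!: exI[of _ "unit_vec n 0"])
  have bdd: "bdd_below S"
  proof (rule bdd_belowI)
    fix y assume "y \<in> S"
    then obtain v where v: "v \<in> carrier_vec n" "enorm v = 1" "y = (A *\<^sub>v v) \<bullet> v" by (auto simp: S_def)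
    then have "\<bar>y\<bar> \<le> enorm (A *\<^sub>v v) * enorm v" using A abs_scalar_prod_le[of "A *\<^sub>v v" n v] by simp
    then show "- K \<le> y" using K(2)[OF v(1)] v by simp
  qed
  have low: "m * (enorm v)\<^sup>2 \<le> (A *\<^sub>v v) \<bullet> v" if v: "v \<in> carrier_vec n" for v
  proof (cases "enorm v = 0")
    case True
    then show ?thesis using v A by (simp add: enorm_eq_0_iff)
  next
    case False
    define u where "u = (1 / enorm v) \<cdot>\<^sub>v v"
    have "u \<in> carrier_vec n" "enorm u = 1" using v False by (auto simp: u_def)
    then have "m \<le> (A *\<^sub>v u) \<bullet> u" unfolding m_def using bdd by (intro cInf_lower) (auto simp: S_def)
    also have "\<dots> = ((A *\<^sub>v v) \<bullet> v) / (enorm v)\<^sup>2"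
      using A v by (simp add: u_def mult_mat_vec power2_eq_square)
    finally show ?thesis using False by (simp add: pos_le_divide_eq)
  qed
  define B where "B = char_matrix A m"
  have B: "B \<in> carrier_mat n n" using A by (simp add: B_def)
  have Bv: "B *\<^sub>v v = A *\<^sub>v v - m \<cdot>\<^sub>v v" if "v \<in> carrier_vec n" for v
    using A that unfolding B_def char_matrix_def
    by (subst add_mult_distrib_mat_vec[of _ n n]) (auto simp: smult_one_mult_mat_vec minus_add_uminus_vec[of _ n])
  have Bq: "(B *\<^sub>v u) \<bullet> v = (A *\<^sub>v u) \<bullet> v - m * (u \<bullet> v)" if "u \<in> carrier_vec n" "v \<in> carrier_vec n" for u v
    using A that by (simp add: Bv minus_scalar_prod_distrib[of _ n])
  have symB: "(B *\<^sub>v u) \<bullet> v = (B *\<^sub>v v) \<bullet> u" if "u \<in> carrier_vec n" "v \<in> carrier_vec n" for u v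
    using that sym[OF that] comm_scalar_prod[OF that] by (simp add: Bq)
  have psdB: "0 \<le> (B *\<^sub>v v) \<bullet> v" if "v \<in> carrier_vec n" for v
    using low[OF that] that by (simp add: Bq enorm_power2)
  have "eigenvalue A m"
  proof (rule ccontr)
    assume "\<not> eigenvalue A m"
    then have "det B \<noteq> 0" using eigenvalue_det[OF A] by (simp add: B_def)
    from det_non_zero_imp_unit[OF B this, of "()"] obtain C
      where C: "C \<in> carrier_mat n n" "C * B = 1\<^sub>m n"
      by (auto simp: Units_def ring_mat_def)
    obtain K1 where K1: "K1 > 0" "\<And>v. v \<in> carrier_vec n \<Longrightarrow> enorm (C *\<^sub>v v) \<le> K1 * enorm v"
      using enorm_mult_mat_vec_bound[OF C(1)] by blast
    obtain K2 where K2: "K2 > 0" "\<And>v. v \<in> carrier_vec n \<Longrightarrow> enorm (B *\<^sub>v v) \<le> K2 * enorm v"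
      using enorm_mult_mat_vec_bound[OF B] by blast
    \<comment> \<open>On the sphere, \<open>1 = enorm (C (B v)) \<le> K1 * enorm (B v)\<close>,
      while the squared norm of \<open>B v\<close> is at most \<open>K2\<close> times the form.
      Hence the form of \<open>B\<close> is at least \<open>1 / (K1\<^sup>2 * K2)\<close> there,
      which pushes the infimum \<open>m\<close> above itself.\<close>
    have "m + 1 / (K1\<^sup>2 * K2) \<le> y" if "y \<in> S" for y
    proof -
      obtain v where v: "v \<in> carrier_vec n" "enorm v = 1" "y = (A *\<^sub>v v) \<bullet> v"
        using \<open>y \<in> S\<close> by (auto simp: S_def)
      have "C *\<^sub>v (B *\<^sub>v v) = v" using B C v by (simp flip: assoc_mult_mat_vec)
      then have "1 \<le> K1 * enorm (B *\<^sub>v v)" using K1(2)[of "B *\<^sub>v v"] B v by simp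
      then have "1 \<le> (K1 * enorm (B *\<^sub>v v))\<^sup>2" using one_le_power by blast
      also have "\<dots> = K1\<^sup>2 * (enorm (B *\<^sub>v v))\<^sup>2" by (simp add: power_mult_distrib)
      also have "\<dots> \<le> K1\<^sup>2 * (K2 * ((B *\<^sub>v v) \<bullet> v))"
        using psd_mult_mat_vec_bound[OF B symB psdB K2 v(1)] by (intro mult_left_mono) auto
      also have "(B *\<^sub>v v) \<bullet> v = y - m"
        using Bq[OF v(1) v(1)] v by (simp flip: enorm_power2)
      finally have "1 \<le> (K1\<^sup>2 * K2) * (y - m)" by (simp add: mult.assoc)
      moreover have "K1\<^sup>2 * K2 > 0" using K1 K2 by simp
      ultimately have "1 / (K1\<^sup>2 * K2) \<le> y - m" by (simp add: pos_divide_le_eq mult.commute)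
      then show ?thesis by simp
    qed
    then have "m + 1 / (K1\<^sup>2 * K2) \<le> m" unfolding m_def by (intro cInf_greatest ne)
    then show False using K1 K2 by (simp add: divide_le_0_iff mult_le_0_iff)
  qed
  with low show ?thesis by blast
qed

text \<open>\<open>Min\<close> of an empty spectrum would be unspecified; the eigenvalue
  \<open>m\<close> of the previous lemma rules this out. The lower bound passes from
  \<open>m\<close> to \<open>lambda_min A\<close> because the latter is no larger.\<close>

lemma lambda_min_symmetric:
  fixes A :: "real mat"
  assumes A: "A \<in> carrier_mat n n" and n: "n \<ge> 1"
    and sym: "\<And>u v. u \<in> carrier_vec n \<Longrightarrow> v \<in> carrier_vec n \<Longrightarrow> (A *\<^sub>v u) \<bullet> v = (A *\<^sub>v v) \<bullet> u"
  shows "eigenvalue A (lambda_min A)"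
    and "v \<in> carrier_vec n \<Longrightarrow> lambda_min A * (enorm v)\<^sup>2 \<le> (A *\<^sub>v v) \<bullet> v"
proof -
  obtain m where m: "eigenvalue A m" "\<And>v. v \<in> carrier_vec n \<Longrightarrow> m * (enorm v)\<^sup>2 \<le> (A *\<^sub>v v) \<bullet> v"
    using symmetric_matrix_min_eigenvalue[OF A n sym] by blast
  have fin: "finite (spectrum A)" by (rule card_finite_spectrum[OF A])
  have mem: "m \<in> spectrum A" using m by (simp add: spectrum_def)
  then have "lambda_min A \<in> spectrum A" unfolding lambda_min_def using fin by (intro Min_in) auto
  then show "eigenvalue A (lambda_min A)" by (simp add: spectrum_def)
  assume v: "v \<in> carrier_vec n"
  have "lambda_min A \<le> m" unfolding lambda_min_def using fin mem by (rule Min_le)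
  then have "lambda_min A * (enorm v)\<^sup>2 \<le> m * (enorm v)\<^sup>2" by (intro mult_right_mono) auto
  with m(2)[OF v] show "lambda_min A * (enorm v)\<^sup>2 \<le> (A *\<^sub>v v) \<bullet> v" by simp
qed

section \<open>Hessian bound and properties of the inexact Newton step\<close>

text \<open>For a short multiple \<open>h\<close> of \<open>v\<close>, \<open>A h\<close> is a
  gradient difference up to \<open>e' * enorm h\<close>; dividing by the scale \<open>s\<close>
  leaves an arbitrarily small error. Unlike the row bound, this one does not depend on the
  dimension.\<close>

lemma jacobian_bound_lipschitz:
  assumes lip: "lipschitz_Rn n L g" and gc: "\<And>y. y \<in> carrier_vec n \<Longrightarrow> g y \<in> carrier_vec n"
    and jac: "has_jacobian n g A x" and x: "x \<in> carrier_vec n" and v: "v \<in> carrier_vec n"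
  shows "enorm (A *\<^sub>v v) \<le> L * enorm v"
proof (rule field_le_epsilon)
  fix e :: real assume e: "e > 0"
  have A: "A \<in> carrier_mat n n" using jac by (simp add: has_jacobian_def)
  define e' where "e' = e / (enorm v + 1)"
  have pos: "enorm v + 1 > 0" by (simp add: add_nonneg_pos)
  then have "e' > 0" using e by (simp add: e'_def)
  then obtain r where r: "r > 0"
    "\<And>h. h \<in> carrier_vec n \<Longrightarrow> enorm h < r \<Longrightarrow> enorm (g (x + h) - g x - A *\<^sub>v h) \<le> e' * enorm h"
    using jac by (auto simp: has_jacobian_def)
  define s where "s = r / (enorm v + 1)"
  have s: "s > 0" using r pos by (simp add: s_def)
  define h where "h = s \<cdot>\<^sub>v v"
  have h: "h \<in> carrier_vec n" using v by (simp add: h_def)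
  have "enorm h = s * enorm v" using s by (simp add: h_def)
  also have "\<dots> < s * (enorm v + 1)" using s by simp
  also have "\<dots> = r" using pos by (simp add: s_def)
  finally have hr: "enorm h < r" .
  have gx: "g x \<in> carrier_vec n" "g (x + h) \<in> carrier_vec n" using gc x h by auto
  have "A *\<^sub>v h = (g (x + h) - g x) - (g (x + h) - g x - A *\<^sub>v h)"
    using A h gx by (intro eq_vecI) auto
  then have "enorm (A *\<^sub>v h) \<le> enorm (g (x + h) - g x) + enorm (g (x + h) - g x - A *\<^sub>v h)"
    using enorm_triangle_minus[of "g (x + h) - g x" n "g (x + h) - g x - A *\<^sub>v h"] gx A h by simp
  also have "x + h - x = h" using x h by (intro eq_vecI) auto
  then have "enorm (g (x + h) - g x) \<le> L * enorm h" using lip x h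
    by (metis add_carrier_vec lipschitz_Rn_def)
  also have "enorm (g (x + h) - g x - A *\<^sub>v h) \<le> e' * enorm h" using r(2)[OF h hr] .
  finally have "s * enorm (A *\<^sub>v v) \<le> s * (L * enorm v + e' * enorm v)"
    using s A v by (simp add: h_def mult_mat_vec algebra_simps)
  then have "enorm (A *\<^sub>v v) \<le> L * enorm v + e' * enorm v" using s by simp
  also have "e' * enorm v \<le> e" using e pos by (simp add: e'_def pos_divide_le_eq)
  finally show "enorm (A *\<^sub>v v) \<le> L * enorm v + e" by simp
qed

lemma inexact_step_bounds:
  assumes A: "A \<in> carrier_mat n n" and n: "n \<ge> 1"
    and sym: "\<And>u v. u \<in> carrier_vec n \<Longrightarrow> v \<in> carrier_vec n \<Longrightarrow> (A *\<^sub>v u) \<bullet> v = (A *\<^sub>v v) \<bullet> u"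
    and bound: "\<And>v. v \<in> carrier_vec n \<Longrightarrow> enorm (A *\<^sub>v v) \<le> L * enorm v"
    and L: "L \<ge> 0" and c: "c > 0" and mu: "0 < \<mu>\<^sub>2" "\<mu>\<^sub>2 \<le> \<mu>\<^sub>1" "\<mu>\<^sub>1 \<le> 1"
    and g: "g \<in> carrier_vec n" and step: "inexact_step n c \<mu>\<^sub>1 \<mu>\<^sub>2 \<delta> g A d"
  shows "g \<bullet> d \<le> - c * (enorm d)\<^sup>2" and "enorm g \<le> (2 * L + c + 2) * enorm d"
proof -
  \<comment> \<open>Only \<open>0 \<le> m \<le> 1\<close> is used of this factor, so \<delta> leaves
    no trace in the constants.\<close>
  define m where "m = min 1 (rpow (enorm g) \<delta>)"
  have m: "0 \<le> m" "m \<le> 1" by (auto simp: m_def rpow_def)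
  define \<sigma> where "\<sigma> = reg_param c \<mu>\<^sub>1 \<delta> g A"
  have \<sigma>: "\<sigma> = max 0 (- lambda_min A) + c + \<mu>\<^sub>1 * m" by (simp add: \<sigma>_def reg_param_def m_def)
  have d: "d \<in> carrier_vec n" using step by (simp add: inexact_step_def)
  define r where "r = A *\<^sub>v d + \<sigma> \<cdot>\<^sub>v d + g"
  have Ad: "A *\<^sub>v d \<in> carrier_vec n" using A d by simp
  have rc: "r \<in> carrier_vec n" using Ad d g by (simp add: r_def)
  have "(A + \<sigma> \<cdot>\<^sub>m 1\<^sub>m n) *\<^sub>v d = A *\<^sub>v d + \<sigma> \<cdot>\<^sub>v d"
    using A d by (subst add_mult_distrib_mat_vec[of _ n n]) (auto simp: smult_one_mult_mat_vec)
  then have r: "enorm r \<le> \<mu>\<^sub>2 / 2 * m * enorm d"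
    using step by (simp add: inexact_step_def \<sigma>_def m_def r_def)
  have mu_m: "0 \<le> \<mu>\<^sub>2 * m" "\<mu>\<^sub>2 * m \<le> \<mu>\<^sub>1 * m" "\<mu>\<^sub>1 * m \<le> 1"
    using m mu by (auto intro: mult_right_mono mult_le_one)
  have geq: "g = r - (A *\<^sub>v d + \<sigma> \<cdot>\<^sub>v d)"
    unfolding r_def using Ad d g by (intro eq_vecI) auto

  have "g \<bullet> d = r \<bullet> d - ((A *\<^sub>v d) \<bullet> d + \<sigma> * (d \<bullet> d))"
    by (subst geq) (use rc Ad d in \<open>simp add: minus_scalar_prod_distrib[of _ n] add_scalar_prod_distrib[of _ n]\<close>)
  also have "d \<bullet> d = (enorm d)\<^sup>2" by (simp add: enorm_power2)
  finally have gd: "g \<bullet> d = r \<bullet> d - ((A *\<^sub>v d) \<bullet> d + \<sigma> * (enorm d)\<^sup>2)" .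
  have "r \<bullet> d \<le> enorm r * enorm d" using abs_scalar_prod_le[OF rc d] by simp
  also have "\<dots> \<le> (\<mu>\<^sub>2 / 2 * m * enorm d) * enorm d" using r by (intro mult_right_mono) auto
  also have "\<dots> = \<mu>\<^sub>2 * m / 2 * (enorm d)\<^sup>2" by (simp add: power2_eq_square)
  finally have "g \<bullet> d \<le> (\<mu>\<^sub>2 * m / 2 - lambda_min A - \<sigma>) * (enorm d)\<^sup>2"
    using lambda_min_symmetric(2)[OF A n sym d] gd by (simp add: algebra_simps)
  \<comment> \<open>Since \<open>\<sigma> \<ge> - lambda_min A + c + \<mu>\<^sub>1 * m\<close>, the
    factor is at most \<open>- c + (\<mu>\<^sub>2 / 2 - \<mu>\<^sub>1) * m\<close>, and \<mu>-terms
    cancel favourably because \<open>\<mu>\<^sub>2 \<le> \<mu>\<^sub>1\<close>.\<close>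
  also have "\<dots> \<le> - c * (enorm d)\<^sup>2" using mu_m by (intro mult_right_mono) (auto simp: \<sigma>)
  finally show "g \<bullet> d \<le> - c * (enorm d)\<^sup>2" .

  \<comment> \<open>Testing the bound \<open>L\<close> on an eigenvector gives
    \<open>\<bar>lambda_min A\<bar> \<le> L\<close>, hence an upper bound for the
    regularization.\<close>
  obtain w where w: "w \<in> carrier_vec n" "w \<noteq> 0\<^sub>v n" "A *\<^sub>v w = lambda_min A \<cdot>\<^sub>v w"
    using lambda_min_symmetric(1)[OF A n sym] A by (auto simp: eigenvalue_def eigenvector_def)
  then have "enorm w > 0" using enorm_eq_0_iff[OF w(1)] by (simp add: order_less_le)
  moreover have "\<bar>lambda_min A\<bar> * enorm w \<le> L * enorm w" using bound[OF w(1)] w(3) by simp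
  ultimately have "\<bar>lambda_min A\<bar> \<le> L" by simp
  then have \<sigma>_le: "0 \<le> \<sigma>" "\<sigma> \<le> L + c + 1" using L c mu_m by (auto simp: \<sigma>)
  have "enorm g \<le> enorm r + enorm (A *\<^sub>v d + \<sigma> \<cdot>\<^sub>v d)"
    using rc Ad d by (subst geq) (auto intro: enorm_triangle_minus)
  also have "enorm (A *\<^sub>v d + \<sigma> \<cdot>\<^sub>v d) \<le> L * enorm d + \<sigma> * enorm d"
    using enorm_triangle[of "A *\<^sub>v d" n "\<sigma> \<cdot>\<^sub>v d"] Ad d \<sigma>_le bound[OF d] by simp
  also note r
  finally have "enorm g \<le> (\<mu>\<^sub>2 * m / 2 + L + \<sigma>) * enorm d" by (simp add: algebra_simps)
  \<comment> \<open>\<open>L\<close> comes from the Hessian, \<open>L + c + 1\<close> from \<sigma>,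
    and the residual's share, at most 1/2, is rounded up to 1.\<close>
  also have "\<dots> \<le> (2 * L + c + 2) * enorm d" using mu_m \<sigma>_le by (intro mult_right_mono) auto
  finally show "enorm g \<le> (2 * L + c + 2) * enorm d" .
qed

section \<open>Line search and decrease per iteration\<close>

text \<open>The mean value theorem avoids integration at the price of \<open>L\<close> instead of
  the sharp \<open>L / 2\<close>, which affects only the constant.\<close>

lemma lipschitz_gradient_upper_bound:
  assumes grad: "\<And>y. y \<in> carrier_vec n \<Longrightarrow> has_gradient n f (g y) y"
    and lip: "lipschitz_Rn n L g"
    and x: "x \<in> carrier_vec n" and d: "d \<in> carrier_vec n" and a: "a > 0"
  shows "f (x + a \<cdot>\<^sub>v d) \<le> f x + a * (g x \<bullet> d) + L * a\<^sup>2 * (enorm d)\<^sup>2"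
proof -
  have gc: "g y \<in> carrier_vec n" if "y \<in> carrier_vec n" for y
    using grad[OF that] by (simp add: has_gradient_def)
  define F where "F t = f (x + t \<cdot>\<^sub>v d)" for t
  have "(F has_real_derivative g (x + t \<cdot>\<^sub>v d) \<bullet> d) (at t)" for t
    unfolding F_def by (rule has_gradient_line_derivative[OF grad x d])
  then obtain t where t: "0 < t" "t < a" and mvt: "F a - F 0 = (a - 0) * (g (x + t \<cdot>\<^sub>v d) \<bullet> d)"
    using MVT2[of 0 a F "\<lambda>t. g (x + t \<cdot>\<^sub>v d) \<bullet> d"] a by auto
  let ?y = "x + t \<cdot>\<^sub>v d"
  have y: "?y \<in> carrier_vec n" using x d by simp
  have L: "L \<ge> 0" using lip by (simp add: lipschitz_Rn_def)
  have "?y - x = t \<cdot>\<^sub>v d" using x d by (intro eq_vecI) auto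
  moreover have "enorm (g ?y - g x) \<le> L * enorm (?y - x)" using lip x y by (simp add: lipschitz_Rn_def)
  ultimately have "enorm (g ?y - g x) \<le> L * t * enorm d" using t by simp
  also have "\<dots> \<le> L * a * enorm d" using L t by (intro mult_right_mono mult_left_mono) auto
  finally have "enorm (g ?y - g x) * enorm d \<le> (L * a * enorm d) * enorm d"
    by (intro mult_right_mono) auto
  moreover have "(g ?y - g x) \<bullet> d \<le> enorm (g ?y - g x) * enorm d"
    using abs_scalar_prod_le[of "g ?y - g x" n d] gc x y d by simp
  moreover have "(g ?y - g x) \<bullet> d = g ?y \<bullet> d - g x \<bullet> d"
    using gc x y d by (simp add: minus_scalar_prod_distrib[of _ n])
  ultimately have "g ?y \<bullet> d \<le> g x \<bullet> d + L * a * (enorm d)\<^sup>2" by (simp add: power2_eq_square)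
  then have "F a - F 0 \<le> a * (g x \<bullet> d + L * a * (enorm d)\<^sup>2)" using mvt a by simp
  moreover have "x + 0 \<cdot>\<^sub>v d = x" using x d by (intro eq_vecI) auto
  ultimately show ?thesis by (simp add: F_def power2_eq_square algebra_simps)
qed

text \<open>For \<open>j = 0\<close> the full step is accepted and the bound is at most 1. Otherwise
  the preceding trial \<open>a\<close>, larger by a factor \<open>1 / \<theta>\<close>, failed;
  comparing its failure with the upper bound for \<open>f\<close> shows that \<open>a\<close> cannot
  be small.\<close>

lemma line_search_step_lower_bound:
  assumes grad: "\<And>y. y \<in> carrier_vec n \<Longrightarrow> has_gradient n f (g y) y"
    and lip: "lipschitz_Rn n L g"
    and x: "x \<in> carrier_vec n" and d: "d \<in> carrier_vec n"
    and desc: "g x \<bullet> d \<le> - c * (enorm d)\<^sup>2"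
    and par: "0 < \<tau>" "\<tau> < c" "0 < \<theta>" "\<theta> < 1"
    and rej: "\<And>i. i < j \<Longrightarrow> \<not> sufficient_decrease f \<tau> \<theta> x d i"
  shows "\<theta> * c / (2 * (L + c)) \<le> \<theta> ^ j"
proof (cases j)
  case 0
  have L: "L \<ge> 0" using lip by (simp add: lipschitz_Rn_def)
  have "\<theta> * c \<le> 1 * c" using par by (intro mult_right_mono) auto
  then have "\<theta> * c \<le> 2 * (L + c)" using L par by argo
  then show ?thesis using 0 L par by (simp add: pos_divide_le_eq)
next
  case (Suc i)
  have L: "L \<ge> 0" using lip by (simp add: lipschitz_Rn_def)
  define a where "a = \<theta> ^ i"
  have a: "a > 0" using par by (simp add: a_def)
  have "f x - \<tau> / 2 * a * (enorm d)\<^sup>2 < f (x + a \<cdot>\<^sub>v d)"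
    using rej[of i] Suc by (simp add: sufficient_decrease_def a_def)
  also have "\<dots> \<le> f x + a * (g x \<bullet> d) + L * a\<^sup>2 * (enorm d)\<^sup>2"
    by (rule lipschitz_gradient_upper_bound[OF grad lip x d a])
  also have "\<dots> \<le> f x + a * (- c * (enorm d)\<^sup>2) + L * a\<^sup>2 * (enorm d)\<^sup>2"
    using mult_left_mono[OF desc, of a] a by simp
  finally have "0 < (a * (enorm d)\<^sup>2) * (\<tau> / 2 - c + L * a)"
    by (simp add: algebra_simps power2_eq_square)
  moreover have "0 \<le> a * (enorm d)\<^sup>2" using a by simp
  \<comment> \<open>The sign argument also covers \<open>d = 0\<close>: the product would vanish,
    contradicting the strict inequality.\<close>
  ultimately have "0 < \<tau> / 2 - c + L * a" by (auto simp only: zero_less_mult_iff)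
  \<comment> \<open>From \<tau> < \<open>c\<close> follows \<open>c / 2 < L * a\<close>. Enlarging
    \<open>L\<close> to \<open>L + c\<close> keeps the later division safe when
    \<open>L = 0\<close>.\<close>
  then have "c / 2 \<le> (L + c) * a" using par a by (simp add: distrib_right add_increasing2)
  then have "\<theta> * c \<le> 2 * (L + c) * (\<theta> * a)"
    using mult_left_mono[of "c / 2" "(L + c) * a" \<theta>] par by (simp add: algebra_simps)
  then show ?thesis using L par Suc by (simp add: a_def pos_divide_le_eq mult_ac)
qed

text \<open>The three factors of \<kappa> are the line search coefficient, the least accepted step
  size, and the squared ratio between step and gradient lengths. None involves \<open>n\<close>,
  \<delta> or the \<mu>-parameters.\<close>

lemma newton_sequence_decrease:
  assumes C2: "C2_with n f g H" and n: "n \<ge> 1" and lip: "lipschitz_Rn n L g"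
    and x0: "x\<^sub>0 \<in> carrier_vec n"
    and mu: "0 < \<mu>\<^sub>2" "\<mu>\<^sub>2 \<le> \<mu>\<^sub>1" "\<mu>\<^sub>1 \<le> 1"
    and par: "0 < \<tau>" "\<tau> < c" "0 < \<theta>" "\<theta> < 1"
    and seq: "newton_sequence n f g H c \<tau> \<theta> \<mu>\<^sub>1 \<mu>\<^sub>2 \<delta> x\<^sub>0 x"
  defines "\<kappa> \<equiv> \<tau> / 2 * (\<theta> * c / (2 * (L + c))) / (2 * L + c + 2)\<^sup>2"
  shows "x k \<in> carrier_vec n" and "f (x (Suc k)) \<le> f (x k) - \<kappa> * (enorm (g (x k)))\<^sup>2"
proof -
  obtain d j where step: "\<And>k. inexact_step n c \<mu>\<^sub>1 \<mu>\<^sub>2 \<delta> (g (x k)) (H (x k)) (d k)"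
    and dec: "\<And>k. sufficient_decrease f \<tau> \<theta> (x k) (d k) (j k)"
    and rej: "\<And>k i. i < j k \<Longrightarrow> \<not> sufficient_decrease f \<tau> \<theta> (x k) (d k) i"
    and x_Suc: "\<And>k. x (Suc k) = x k + \<theta> ^ j k \<cdot>\<^sub>v d k"
    using seq unfolding newton_sequence_def by blast
  have d: "d k \<in> carrier_vec n" for k using step[of k] by (simp add: inexact_step_def)
  have xc: "x k \<in> carrier_vec n" for k
  proof (induction k)
    case 0
    show ?case using seq x0 by (simp add: newton_sequence_def)
  next
    case (Suc k)
    then show ?case using d by (simp add: x_Suc)
  qed
  then show "x k \<in> carrier_vec n" .
  have grad: "\<And>y. y \<in> carrier_vec n \<Longrightarrow> has_gradient n f (g y) y"
    and jac: "has_jacobian n g (H (x k)) (x k)"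
    using C2 xc by (auto simp: C2_with_def)
  have gc: "g y \<in> carrier_vec n" if "y \<in> carrier_vec n" for y
    using grad[OF that] by (simp add: has_gradient_def)
  have A: "H (x k) \<in> carrier_mat n n" using jac by (simp add: has_jacobian_def)
  have L: "L \<ge> 0" using lip by (simp add: lipschitz_Rn_def)
  have c: "c > 0" using par by simp
  note bounds = inexact_step_bounds[OF A n hessian_symmetric[OF grad jac xc]
      jacobian_bound_lipschitz[OF lip gc jac xc] L c mu gc[OF xc] step]
  define \<alpha> where "\<alpha> = \<theta> * c / (2 * (L + c))"
  define M where "M = 2 * L + c + 2"
  have M: "M > 0" and \<alpha>: "\<alpha> > 0" using L c par by (auto simp: M_def \<alpha>_def)
  have \<alpha>_le: "\<alpha> \<le> \<theta> ^ j k" unfolding \<alpha>_def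
    by (rule line_search_step_lower_bound[OF grad lip xc d bounds(1) par rej])
  have "enorm (g (x k)) / M \<le> enorm (d k)"
    using bounds(2) M by (simp add: M_def pos_divide_le_eq mult.commute)
  then have "(enorm (g (x k)) / M)\<^sup>2 \<le> (enorm (d k))\<^sup>2" using M by (intro power_mono) auto
  then have "(\<tau> / 2 * \<alpha>) * (enorm (g (x k)) / M)\<^sup>2 \<le> (\<tau> / 2 * \<theta> ^ j k) * (enorm (d k))\<^sup>2"
    using \<alpha>_le \<alpha> par by (intro mult_mono) auto
  moreover have "\<kappa> * (enorm (g (x k)))\<^sup>2 = (\<tau> / 2 * \<alpha>) * (enorm (g (x k)) / M)\<^sup>2"
    by (simp add: \<kappa>_def \<alpha>_def M_def power_divide)
  moreover have "f (x (Suc k)) \<le> f (x k) - \<tau> / 2 * \<theta> ^ j k * (enorm (d k))\<^sup>2"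
    using dec[of k] by (simp add: sufficient_decrease_def x_Suc)
  ultimately show "f (x (Suc k)) \<le> f (x k) - \<kappa> * (enorm (g (x k)))\<^sup>2" by linarith
qed

section \<open>Counting iterations and the complexity bound\<close>

text \<open>If every \<open>G k\<close> up to the bound exceeded \<epsilon>, each step would cost at
  least \<open>\<kappa> * \<epsilon>\<^sup>2\<close>, and their sum would exceed the available
  decrease \<open>F 0 - m\<close>.\<close>

lemma small_term_from_quadratic_decrease:
  fixes F G :: "nat \<Rightarrow> real"
  assumes dec: "\<And>k. F (Suc k) \<le> F k - \<kappa> * (G k)\<^sup>2" and low: "\<And>k. m \<le> F k"
    and \<kappa>: "\<kappa> > 0" and \<epsilon>: "\<epsilon> > 0"
  shows "\<exists>k. real k \<le> (F 0 - m) / \<kappa> / \<epsilon>\<^sup>2 \<and> G k \<le> \<epsilon>"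
proof (rule ccontr)
  assume none: "\<nexists>k. real k \<le> (F 0 - m) / \<kappa> / \<epsilon>\<^sup>2 \<and> G k \<le> \<epsilon>"
  define B where "B = (F 0 - m) / \<kappa> / \<epsilon>\<^sup>2"
  have B: "B \<ge> 0" using low[of 0] \<kappa> by (simp add: B_def)
  \<comment> \<open>The first integer above \<open>B\<close>. The \<open>N\<close> decreases leading
    to \<open>F N\<close> occur at indices 0 to \<open>N - 1\<close>, all of them at most
    \<open>B\<close>.\<close>
  define N where "N = nat \<lfloor>B\<rfloor> + 1"
  have N: "B < real N" using B by (simp add: N_def) linarith
  have "F k \<le> F 0 - real k * (\<kappa> * \<epsilon>\<^sup>2)" if "k \<le> N" for k
    using that
  proof (induction k)
    case (Suc k)
    have "real k \<le> B" using Suc.prems B by (simp add: N_def le_nat_floor le_nat_iff le_floor_iff)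
    then have "\<epsilon> < G k" using none B_def by (metis not_le)
    then have "\<kappa> * \<epsilon>\<^sup>2 \<le> \<kappa> * (G k)\<^sup>2" using \<kappa> \<epsilon> by (intro mult_left_mono power_mono) auto
    then show ?case using Suc dec[of k] by (simp add: distrib_right)
  qed simp
  from this[of N] low[of N] have "real N * (\<kappa> * \<epsilon>\<^sup>2) \<le> F 0 - m" by simp
  then have "real N \<le> B" using \<kappa> \<epsilon> by (simp add: B_def pos_le_divide_eq mult_ac)
  with N show False by simp
qed

theorem mainTheorem5:
  fixes L c \<tau> \<theta> \<Delta> :: real
  assumes "c > 0" and "0 < \<tau>" and "\<tau> < c" and "0 < \<theta>" and "\<theta> < 1"
  shows "\<exists>C>0. \<forall>(n::nat) (f :: real vec \<Rightarrow> real) (g :: real vec \<Rightarrow> real vec)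
           (H :: real vec \<Rightarrow> real mat) (fmin::real) (\<mu>\<^sub>1::real) (\<mu>\<^sub>2::real) (\<delta>::real)
           (x\<^sub>0 :: real vec) (x :: nat \<Rightarrow> real vec).
           n \<ge> 1 \<longrightarrow>
           C2_with n f g H \<longrightarrow>
           lipschitz_Rn n L g \<longrightarrow>
           is_min_value n f fmin \<longrightarrow>
           (\<forall>z\<in>carrier_vec n. bounded_Rn n {y \<in> carrier_vec n. f y \<le> f z}) \<longrightarrow>
           0 < \<mu>\<^sub>1 \<longrightarrow> \<mu>\<^sub>1 \<le> 1 \<longrightarrow> 0 < \<mu>\<^sub>2 \<longrightarrow> \<mu>\<^sub>2 \<le> \<mu>\<^sub>1 \<longrightarrow> 0 \<le> \<delta> \<longrightarrow> \<delta> \<le> 1 \<longrightarrow>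
           x\<^sub>0 \<in> carrier_vec n \<longrightarrow>
           f x\<^sub>0 - fmin = \<Delta> \<longrightarrow>
           newton_sequence n f g H c \<tau> \<theta> \<mu>\<^sub>1 \<mu>\<^sub>2 \<delta> x\<^sub>0 x \<longrightarrow>
           (\<forall>\<epsilon>. 0 < \<epsilon> \<and> \<epsilon> \<le> 1 \<longrightarrow>
              (\<exists>k. real k \<le> C * \<epsilon> powi (-2) \<and> enorm (g (x k)) \<le> \<epsilon>))"
proof -
  \<comment> \<open>Fixed before the dimension and the function are introduced, so that the constant
    is uniform in both.\<close>
  define \<kappa> where "\<kappa> = \<tau> / 2 * (\<theta> * c / (2 * (L + c))) / (2 * L + c + 2)\<^sup>2"
  show ?thesis
  \<comment> \<open>Positivity of the constant must hold before \<open>L \<ge> 0\<close> or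
    \<open>\<Delta> \<ge> 0\<close> is known; the absolute value and the \<open>+ 1\<close> secure
    it for all real \<open>L\<close> and \<Delta>, including \<Delta> = 0.\<close>
  proof (intro exI[of _ "\<bar>\<Delta> / \<kappa>\<bar> + 1"] conjI allI impI, goal_cases)
    case 1
    show ?case by (simp add: add_nonneg_pos)
  next
    case (2 n f g H fmin \<mu>\<^sub>1 \<mu>\<^sub>2 \<delta> x\<^sub>0 x \<epsilon>)
    note dec = newton_sequence_decrease[OF 2(2,1,3,12,8,9,7) assms(2-5) 2(14), folded \<kappa>_def]
    have "L \<ge> 0" using 2(3) by (simp add: lipschitz_Rn_def)
    then have "\<kappa> > 0" using assms by (simp add: \<kappa>_def add_nonneg_pos)
    moreover have "fmin \<le> f (x k)" for k using 2(4) dec(1) by (auto simp: is_min_value_def)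
    ultimately obtain k where k: "real k \<le> (f (x 0) - fmin) / \<kappa> / \<epsilon>\<^sup>2" "enorm (g (x k)) \<le> \<epsilon>"
      using small_term_from_quadratic_decrease[of "\<lambda>k. f (x k)" \<kappa> "\<lambda>k. enorm (g (x k))" fmin \<epsilon>] dec(2) 2(15)
      by blast
    have "f (x 0) - fmin = \<Delta>" using 2(13,14) by (simp add: newton_sequence_def)
    with k(1) have "real k \<le> \<Delta> / \<kappa> / \<epsilon>\<^sup>2" by simp
    also have "\<dots> \<le> (\<bar>\<Delta> / \<kappa>\<bar> + 1) / \<epsilon>\<^sup>2" using abs_ge_self[of "\<Delta> / \<kappa>"] by (intro divide_right_mono) (linarith, simp)
    also have "\<dots> = (\<bar>\<Delta> / \<kappa>\<bar> + 1) * \<epsilon> powi (-2)" by (simp add: power_int_minus divide_inverse)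
    finally show ?case using k(2) by blast
  qed
qed

end
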